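(* Let $G_1, G_2, G_3$ be pairwise vertex-disjoint 4-critical planar graphs, each with a fixed embedding in the plane. Let $u_1u_2u_3$, $v_1v_2v_3$ and $w_1w_2w_3$ be paths (each on three distinct vertices) lying in the boundary of some face of $G_1$, $G_2$ and $G_3$, respectively. Let $G = G_1\circ G_2\circ G_3$ be the graph obtained from the disjoint union of $G_1,G_2,G_3$ by (a) deleting the edges $u_2u_3$, $v_2v_3$ and $w_2w_3$; (b) identifying $u_1$ with $w_3$, $u_3$ with $v_1$, and $v_3$ with $w_1$; (c) adding a new vertex $z$ and three new edges $zu_2$, $zv_2$, $zw_2$. Then $G$ is a 4-critical graph.
   Context: Graphs are finite and simple. A graph is $k$-colorable if its vertices can be assigned $k$ colors so that adjacent vertices get different colors; $\chi(G)$ is the least $k$ such that $G$ is $k$-colorable. A graph $G$ is 4-critical if $\chi(G)=4$ and $G-e$ is 3-colorable for every edge $e$ of $G$ (where $G-e$ denotes $G$ with the edge $e$ deleted). A planar graph is a graph that can be embedded in the plane, i.e. drawn so that edges intersect only at their endpoints. *)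

theory Defs
  imports "HOL-Analysis.Analysis"
begin

record 'a ugraph =
  verts :: "'a set"
  edges :: "'a set set"

definition simple_graph :: "'a ugraph \<Rightarrow> bool" where
  "simple_graph G \<longleftrightarrow> finite (verts G) \<and> (\<forall>e\<in>edges G. e \<subseteq> verts G \<and> card e = 2)"

definition colorable :: "'a ugraph \<Rightarrow> nat \<Rightarrow> bool" where
  "colorable G k \<longleftrightarrow>
    (\<exists>c :: 'a \<Rightarrow> nat. (\<forall>v\<in>verts G. c v < k) \<and> (\<forall>u v. {u, v} \<in> edges G \<longrightarrow> c u \<noteq> c v))"

definition chromatic_number :: "'a ugraph \<Rightarrow> nat" where
  "chromatic_number G = (LEAST k. colorable G k)"

definition delete_edges :: "'a ugraph \<Rightarrow> 'a set set \<Rightarrow> 'a ugraph" where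
  "delete_edges G F = \<lparr>verts = verts G, edges = edges G - F\<rparr>"

definition four_critical :: "'a ugraph \<Rightarrow> bool" where
  "four_critical G \<longleftrightarrow> simple_graph G \<and> chromatic_number G = 4 \<and>
    (\<forall>e\<in>edges G. colorable (delete_edges G {e}) 3)"

text \<open>
  A drawing places each vertex \<open>v\<close> at the point \<open>p v\<close> and draws each edge \<open>e\<close> as the
  arc \<open>\<gamma> e\<close>, in either direction. The values of \<open>p\<close> off the vertex set and of \<open>\<gamma>\<close> off the
  edge set are irrelevant.
\<close>

definition plane_embedding ::
    "'a ugraph \<Rightarrow> ('a \<Rightarrow> real^2) \<Rightarrow> ('a set \<Rightarrow> real \<Rightarrow> real^2) \<Rightarrow> bool" where
  "plane_embedding G p \<gamma> \<longleftrightarrow>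
    inj_on p (verts G) \<and>
    (\<forall>e\<in>edges G. arc (\<gamma> e) \<and> {pathstart (\<gamma> e), pathfinish (\<gamma> e)} = p ` e \<and>
        path_image (\<gamma> e) \<inter> p ` verts G = p ` e) \<and>
    (\<forall>e\<in>edges G. \<forall>e'\<in>edges G. e \<noteq> e' \<longrightarrow>
        path_image (\<gamma> e) \<inter> path_image (\<gamma> e') \<subseteq> p ` e \<inter> p ` e')"

definition drawing :: "'a ugraph \<Rightarrow> ('a \<Rightarrow> real^2) \<Rightarrow> ('a set \<Rightarrow> real \<Rightarrow> real^2) \<Rightarrow> (real^2) set" where
  "drawing G p \<gamma> = p ` verts G \<union> (\<Union>e\<in>edges G. path_image (\<gamma> e))"

definition faces :: "'a ugraph \<Rightarrow> ('a \<Rightarrow> real^2) \<Rightarrow> ('a set \<Rightarrow> real \<Rightarrow> real^2) \<Rightarrow> (real^2) set set" where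
  "faces G p \<gamma> = components (- drawing G p \<gamma>)"

definition is_path3 :: "'a ugraph \<Rightarrow> 'a \<Rightarrow> 'a \<Rightarrow> 'a \<Rightarrow> bool" where
  "is_path3 G x y t \<longleftrightarrow> distinct [x, y, t] \<and> {x, y} \<in> edges G \<and> {y, t} \<in> edges G"

text \<open>The three vertices are endpoints of the two arcs, so they lie on the boundary as well.\<close>

definition facial_path3 ::
    "'a ugraph \<Rightarrow> ('a \<Rightarrow> real^2) \<Rightarrow> ('a set \<Rightarrow> real \<Rightarrow> real^2) \<Rightarrow> 'a \<Rightarrow> 'a \<Rightarrow> 'a \<Rightarrow> bool" where
  "facial_path3 G p \<gamma> x y t \<longleftrightarrow> is_path3 G x y t \<and>
    (\<exists>f\<in>faces G p \<gamma>. path_image (\<gamma> {x, y}) \<union> path_image (\<gamma> {y, t}) \<subseteq> frontier f)"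

definition graph_union :: "'a ugraph \<Rightarrow> 'a ugraph \<Rightarrow> 'a ugraph" where
  "graph_union G H = \<lparr>verts = verts G \<union> verts H, edges = edges G \<union> edges H\<rparr>"

text \<open>
  The merged vertex keeps the name \<open>x\<close>. An edge joining \<open>x\<close> and \<open>y\<close> would become a singleton
  (a loop), which \<open>simple_graph\<close> rejects; parallel edges collapse to a single one.
\<close>

definition identify :: "'a \<Rightarrow> 'a \<Rightarrow> 'a ugraph \<Rightarrow> 'a ugraph" where
  "identify x y G =
    (let \<sigma> = (\<lambda>t. if t = y then x else t)
     in \<lparr>verts = \<sigma> ` verts G, edges = (\<lambda>e. \<sigma> ` e) ` edges G\<rparr>)"

definition add_vertex :: "'a \<Rightarrow> 'a set \<Rightarrow> 'a ugraph \<Rightarrow> 'a ugraph" where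
  "add_vertex z N G = \<lparr>verts = insert z (verts G), edges = edges G \<union> {{z, x} | x. x \<in> N}\<rparr>"

text \<open>
  The three identifications concern disjoint pairs of vertices, none of which contains
  \<open>u\<^sub>2\<close>, \<open>v\<^sub>2\<close> or \<open>w\<^sub>2\<close>, so their order is irrelevant and these vertices keep their names.
\<close>

definition compose3 ::
    "'a ugraph \<Rightarrow> 'a \<times> 'a \<times> 'a \<Rightarrow> 'a ugraph \<Rightarrow> 'a \<times> 'a \<times> 'a \<Rightarrow>
     'a ugraph \<Rightarrow> 'a \<times> 'a \<times> 'a \<Rightarrow> 'a \<Rightarrow> 'a ugraph" where
  "compose3 G\<^sub>1 = (\<lambda>(u\<^sub>1, u\<^sub>2, u\<^sub>3) G\<^sub>2 (v\<^sub>1, v\<^sub>2, v\<^sub>3) G\<^sub>3 (w\<^sub>1, w\<^sub>2, w\<^sub>3) z.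
    add_vertex z {u\<^sub>2, v\<^sub>2, w\<^sub>2}
     (identify u\<^sub>1 w\<^sub>3 (identify u\<^sub>3 v\<^sub>1 (identify v\<^sub>3 w\<^sub>1
       (delete_edges (graph_union G\<^sub>1 (graph_union G\<^sub>2 G\<^sub>3))
         {{u\<^sub>2, u\<^sub>3}, {v\<^sub>2, v\<^sub>3}, {w\<^sub>2, w\<^sub>3}})))))"

end

theory Submission
  imports Defs "HOL-Combinatorics.Transposition"
begin

text \<open>
  Deleting the edge \<open>yt\<close> from a 4-critical graph that contains the path \<open>xyt\<close>
  leaves a gadget whose 3-colourings all satisfy \<open>c y = c t\<close>, since otherwise the deleted edge
  could be restored (\<open>gadget_forces\<close>). As \<open>xy\<close> is still an edge, \<open>c x \<noteq> c t\<close>, and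
  permuting colours realises every such pattern (\<open>gadget_realises\<close>). So a gadget acts like an
  edge joining its ends \<open>x\<close> and \<open>t\<close>, with the colour of \<open>t\<close> copied to \<open>y\<close>.

  The composition joins three gadgets cyclically at their ends. In a 3-colouring the three
  junctions would form a triangle and so carry all three colours, and the middle vertices
  \<open>u\<^sub>2\<close>, \<open>v\<^sub>2\<close>, \<open>w\<^sub>2\<close> copy these; hence \<open>z\<close> cannot be coloured, while a fourth colour for \<open>z\<close>
  suffices. If a spoke at \<open>z\<close> is deleted, \<open>z\<close> takes the colour that this spoke
  excluded. If an edge of a gadget is deleted, the damaged gadget has a 3-colouring in which
  \<open>y\<close> and \<open>t\<close> differ, because the 4-critical graph it came from
  becomes 3-colourable; then the opposite junction can be coloured so that the middle vertices
  show just two colours, and a colour remains for \<open>z\<close> (\<open>recolour_after_deletion\<close>).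

  Identifying vertices amounts to taking the image under a map \<open>\<tau>\<close>. Colourings of the quotient
  are colourings of the disjoint union that are constant on the fibres of \<open>\<tau>\<close>, so all the
  combinatorics takes place in the disjoint union.
\<close>

section \<open>Colourings of edge sets and of quotients\<close>

text \<open>
  Properness is expressed through \<open>c ` e\<close> because images compose: colourings can then be pulled
  back along a vertex map, or composed with a permutation of the colours, without naming the ends
  of an edge.
\<close>

definition colouring :: "nat \<Rightarrow> 'a set \<Rightarrow> 'a set set \<Rightarrow> ('a \<Rightarrow> nat) \<Rightarrow> bool" where
  "colouring k V E c \<longleftrightarrow> c ` V \<subseteq> {..<k} \<and> (\<forall>e\<in>E. card (c ` e) = 2)"

lemma colouring_edge: "colouring k V E c \<Longrightarrow> {x, y} \<in> E \<Longrightarrow> c x \<noteq> c y"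
  unfolding colouring_def by (cases "c x = c y") auto

lemma colouring_bound: "colouring k V E c \<Longrightarrow> x \<in> V \<Longrightarrow> c x < k"
  unfolding colouring_def by auto

lemma colouring_subset_edges: "colouring k V E c \<Longrightarrow> E' \<subseteq> E \<Longrightarrow> colouring k V E' c"
  unfolding colouring_def by auto

lemma colouring_mono_colours: "colouring k V E c \<Longrightarrow> k \<le> l \<Longrightarrow> colouring l V E c"
  unfolding colouring_def by auto

lemma colouring_imp_colorable: "colouring k (verts G) (edges G) c \<Longrightarrow> colorable G k"
  unfolding colorable_def
  by (intro exI[of _ c] conjI ballI allI impI) (auto dest: colouring_edge colouring_bound)

lemma colorable_iff_colouring:
  assumes "simple_graph G"
  shows "colorable G k \<longleftrightarrow> (\<exists>c. colouring k (verts G) (edges G) c)"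
proof
  assume "colorable G k"
  then obtain c where c: "\<forall>v\<in>verts G. c v < k" "\<forall>u v. {u, v} \<in> edges G \<longrightarrow> c u \<noteq> c v"
    unfolding colorable_def by blast
  have "card (c ` e) = 2" if "e \<in> edges G" for e
  proof -
    have "card e = 2" using assms that by (simp add: simple_graph_def)
    then obtain u v where "e = {u, v}" by (auto simp: card_2_iff)
    with that c(2) show ?thesis by auto
  qed
  with c(1) show "\<exists>c. colouring k (verts G) (edges G) c"
    unfolding colouring_def by auto
qed (elim exE, rule colouring_imp_colorable)

lemma colorable_mono:
  assumes "colorable G k" "k \<le> l" shows "colorable G l"
proof -
  obtain c where c: "\<forall>v\<in>verts G. c v < k" "\<forall>u v. {u, v} \<in> edges G \<longrightarrow> c u \<noteq> c v"
    using assms(1) unfolding colorable_def by blast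
  then have "\<forall>v\<in>verts G. c v < l" using assms(2) by auto
  with c(2) show ?thesis unfolding colorable_def by (intro exI[of _ c] conjI)
qed

lemma chromatic_number_eqI:
  assumes "colorable G (Suc k)" "\<not> colorable G k"
  shows "chromatic_number G = Suc k"
  unfolding chromatic_number_def
proof (rule Least_equality)
  show "Suc k \<le> l" if "colorable G l" for l
    using colorable_mono[OF that, of k] assms(2) by linarith
qed (rule assms(1))

lemma colouring_pullback_iff:
  "colouring k (\<tau> ` V) ((`) \<tau> ` E) c \<longleftrightarrow> colouring k V E (c \<circ> \<tau>)"
  unfolding colouring_def by (simp add: image_comp)

lemma colouring_permute:
  assumes "colouring k V E c" "inj \<pi>" "\<pi> ` {..<k} \<subseteq> {..<k}"
  shows "colouring k V E (\<pi> \<circ> c)"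
proof -
  have "card ((\<pi> \<circ> c) ` e) = card (c ` e)" for e
    using card_image[of \<pi> "c ` e"] assms(2) by (simp add: image_comp inj_on_subset)
  then show ?thesis
    using assms unfolding colouring_def by (auto simp: image_subset_iff)
qed

text \<open>A proper colouring that factors through \<open>\<tau>\<close> shows that \<open>\<tau>\<close> collapses no edge to a loop.\<close>

lemma simple_graph_quotient:
  assumes "finite V" "\<forall>e\<in>E. e \<subseteq> V \<and> card e = 2" "colouring k V E (c \<circ> \<tau>)"
  shows "simple_graph \<lparr>verts = \<tau> ` V, edges = (`) \<tau> ` E\<rparr>"
proof -
  have "card (\<tau> ` e) = 2" if "e \<in> E" for e
  proof -
    have "finite e" using assms(1,2) that finite_subset by blast
    then have "card (c ` \<tau> ` e) \<le> card (\<tau> ` e)" "card (\<tau> ` e) \<le> card e"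
      by (auto intro: card_image_le)
    moreover have "card (c ` \<tau> ` e) = 2"
      using assms(3) that unfolding colouring_def by (simp add: image_comp)
    ultimately show ?thesis using assms(2) that by simp
  qed
  with assms(1,2) show ?thesis
    unfolding simple_graph_def by auto
qed

lemma two_colours_leave_third: "\<exists>s<3. s \<noteq> a \<and> s \<noteq> (b::nat)"
  by presburger

section \<open>The gadget: a 4-critical graph minus one edge\<close>

locale gadget =
  fixes G :: "'a ugraph" and x y t :: 'a
  assumes critical: "four_critical G" and path: "is_path3 G x y t"
begin

abbreviation gadget_edges :: "'a set set" where
  "gadget_edges \<equiv> edges G - {{y, t}}"

lemma simple: "simple_graph G"
  using critical unfolding four_critical_def by blast

lemma edge_props: "e \<in> edges G \<Longrightarrow> e \<subseteq> verts G \<and> card e = 2"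
  using simple unfolding simple_graph_def by blast

lemma path_verts: "x \<in> verts G" "y \<in> verts G" "t \<in> verts G"
  using path edge_props unfolding is_path3_def by blast+

lemma path_distinct: "x \<noteq> y" "y \<noteq> t" "x \<noteq> t"
  using path unfolding is_path3_def by auto

lemma first_edge: "{x, y} \<in> gadget_edges"
  using path unfolding is_path3_def by (auto simp: doubleton_eq_iff)

lemma not_3_colouring: "\<not> colouring 3 (verts G) (edges G) c"
proof
  assume "colouring 3 (verts G) (edges G) c"
  then have "chromatic_number G \<le> 3"
    unfolding chromatic_number_def by (intro Least_le colouring_imp_colorable)
  then show False using critical unfolding four_critical_def by simp
qed

lemma colouring_without_edge:
  assumes "e \<in> edges G"
  obtains c where "colouring 3 (verts G) (edges G - {e}) c"
proof -
  have "colorable (delete_edges G {e}) 3"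
    using critical assms unfolding four_critical_def by blast
  moreover have "simple_graph (delete_edges G {e})"
    using simple unfolding simple_graph_def delete_edges_def by auto
  ultimately show thesis
    using that by (auto simp: colorable_iff_colouring delete_edges_def)
qed

lemma gadget_forces:
  assumes "colouring 3 (verts G) gadget_edges c"
  shows "c y = c t" and "c x \<noteq> c t"
proof -
  show "c y = c t"
  proof (rule ccontr)
    assume "c y \<noteq> c t"
    then have "card (c ` {y, t}) = 2" by simp
    with assms have "colouring 3 (verts G) (edges G) c"
      unfolding colouring_def by blast
    then show False using not_3_colouring by blast
  qed
  then show "c x \<noteq> c t"
    using colouring_edge[OF assms first_edge] by simp
qed

lemma gadget_realises:
  assumes "\<alpha> < 3" "\<beta> < 3" "\<alpha> \<noteq> \<beta>"
  obtains c where "colouring 3 (verts G) gadget_edges c" "c x = \<alpha>" "c y = \<beta>" "c t = \<beta>"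
proof -
  have "{y, t} \<in> edges G" using path unfolding is_path3_def by blast
  then obtain c where c: "colouring 3 (verts G) gadget_edges c"
    by (rule colouring_without_edge)
  note forced = gadget_forces[OF c]
  have bounds: "c x < 3" "c t < 3"
    using c path_verts by (auto intro: colouring_bound)
  \<comment> \<open>Move the colour of \<open>x\<close> to \<open>\<alpha>\<close>, then that of \<open>t\<close> to \<open>\<beta>\<close>; the second swap leaves \<open>\<alpha>\<close> alone.\<close>
  define \<pi>1 where "\<pi>1 = Transposition.transpose (c x) \<alpha>"
  define \<pi> where "\<pi> = Transposition.transpose (\<pi>1 (c t)) \<beta> \<circ> \<pi>1"
  have "\<pi>1 (c x) = \<alpha>" "\<pi>1 (c t) \<noteq> \<alpha>" "\<pi>1 (c t) < 3"
    using forced(2) bounds assms(1) by (auto simp: \<pi>1_def Transposition.transpose_def)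
  then have moved: "\<pi> (c x) = \<alpha>" "\<pi> (c t) = \<beta>"
    using assms(3) by (auto simp: \<pi>_def Transposition.transpose_def)
  have "inj \<pi>"
    unfolding \<pi>_def \<pi>1_def by (intro inj_compose inj_transpose)
  moreover have "\<pi> ` {..<3} \<subseteq> {..<3}"
  proof -
    have "Transposition.transpose a b i < 3" if "a < 3" "b < 3" "i < 3" for a b i :: nat
      using that by (simp add: Transposition.transpose_def)
    then have "\<pi> i < 3" if "i < 3" for i
      using that bounds assms(1,2) \<open>\<pi>1 (c t) < 3\<close> by (simp add: \<pi>_def \<pi>1_def)
    then show ?thesis by blast
  qed
  ultimately have "colouring 3 (verts G) gadget_edges (\<pi> \<circ> c)"
    using c by (intro colouring_permute)
  then show thesis
    by (rule that) (use moved forced(1) in auto)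
qed

end

section \<open>Three gadgets in a ring\<close>

locale gadget_ring =
  g1: gadget G\<^sub>1 u\<^sub>1 u\<^sub>2 u\<^sub>3 + g2: gadget G\<^sub>2 v\<^sub>1 v\<^sub>2 v\<^sub>3 + g3: gadget G\<^sub>3 w\<^sub>1 w\<^sub>2 w\<^sub>3
  for G\<^sub>1 :: "'a ugraph" and u\<^sub>1 u\<^sub>2 u\<^sub>3 and G\<^sub>2 :: "'a ugraph" and v\<^sub>1 v\<^sub>2 v\<^sub>3
    and G\<^sub>3 :: "'a ugraph" and w\<^sub>1 w\<^sub>2 w\<^sub>3 +
  fixes z :: 'a
  assumes disj: "verts G\<^sub>1 \<inter> verts G\<^sub>2 = {}" "verts G\<^sub>1 \<inter> verts G\<^sub>3 = {}"
      "verts G\<^sub>2 \<inter> verts G\<^sub>3 = {}"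
    and z_new: "z \<notin> verts G\<^sub>1 \<union> verts G\<^sub>2 \<union> verts G\<^sub>3"
begin

lemma rotate: "gadget_ring G\<^sub>2 v\<^sub>1 v\<^sub>2 v\<^sub>3 G\<^sub>3 w\<^sub>1 w\<^sub>2 w\<^sub>3 G\<^sub>1 u\<^sub>1 u\<^sub>2 u\<^sub>3 z"
  using disj z_new by unfold_locales auto

definition ring_verts :: "'a set" where
  "ring_verts = insert z (verts G\<^sub>1 \<union> verts G\<^sub>2 \<union> verts G\<^sub>3)"

definition ring_edges :: "'a set set" where
  "ring_edges = g1.gadget_edges \<union> g2.gadget_edges \<union> g3.gadget_edges
     \<union> {{z, u\<^sub>2}, {z, v\<^sub>2}, {z, w\<^sub>2}}"

text \<open>
  The vertices to be identified are still distinct here; a colouring of the ring has to give them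
  equal colours.
\<close>

definition ring_colouring :: "nat \<Rightarrow> 'a set set \<Rightarrow> ('a \<Rightarrow> nat) \<Rightarrow> bool" where
  "ring_colouring k D f \<longleftrightarrow> colouring k ring_verts (ring_edges - D) f \<and>
     f u\<^sub>3 = f v\<^sub>1 \<and> f v\<^sub>3 = f w\<^sub>1 \<and> f w\<^sub>3 = f u\<^sub>1"

lemma ring_edge_props:
  assumes "e \<in> ring_edges" shows "e \<subseteq> ring_verts \<and> card e = 2"
proof -
  have "z \<noteq> u\<^sub>2" "z \<noteq> v\<^sub>2" "z \<noteq> w\<^sub>2"
    using z_new g1.path_verts g2.path_verts g3.path_verts by auto
  then show ?thesis
    using assms g1.path_verts g2.path_verts g3.path_verts
      g1.edge_props[of e] g2.edge_props[of e] g3.edge_props[of e]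
    unfolding ring_edges_def ring_verts_def by auto
qed

lemma finite_ring_verts: "finite ring_verts"
  using g1.simple g2.simple g3.simple unfolding simple_graph_def ring_verts_def by simp

text \<open>
  Only the spoke at \<open>u\<^sub>2\<close> is allowed to be missing: by rotation this covers the deletion of any
  spoke.
\<close>

lemma glue_colourings:
  assumes c: "colouring k (verts G\<^sub>1) (g1.gadget_edges - D) c\<^sub>1"
      "colouring k (verts G\<^sub>2) (g2.gadget_edges - D) c\<^sub>2"
      "colouring k (verts G\<^sub>3) (g3.gadget_edges - D) c\<^sub>3"
    and junctions: "c\<^sub>1 u\<^sub>3 = c\<^sub>2 v\<^sub>1" "c\<^sub>2 v\<^sub>3 = c\<^sub>3 w\<^sub>1" "c\<^sub>3 w\<^sub>3 = c\<^sub>1 u\<^sub>1"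
    and s: "s < k" "{z, u\<^sub>2} \<notin> D \<Longrightarrow> s \<noteq> c\<^sub>1 u\<^sub>2" "s \<noteq> c\<^sub>2 v\<^sub>2" "s \<noteq> c\<^sub>3 w\<^sub>2"
  obtains f where "ring_colouring k D f"
proof -
  define f where "f x = (if x \<in> verts G\<^sub>1 then c\<^sub>1 x else if x \<in> verts G\<^sub>2 then c\<^sub>2 x
    else if x \<in> verts G\<^sub>3 then c\<^sub>3 x else s)" for x
  have f: "x \<in> verts G\<^sub>1 \<Longrightarrow> f x = c\<^sub>1 x" "x \<in> verts G\<^sub>2 \<Longrightarrow> f x = c\<^sub>2 x"
      "x \<in> verts G\<^sub>3 \<Longrightarrow> f x = c\<^sub>3 x" "f z = s" for x
    using disj z_new by (auto simp: f_def)
  have img: "e \<subseteq> verts G\<^sub>1 \<Longrightarrow> f ` e = c\<^sub>1 ` e" "e \<subseteq> verts G\<^sub>2 \<Longrightarrow> f ` e = c\<^sub>2 ` e"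
      "e \<subseteq> verts G\<^sub>3 \<Longrightarrow> f ` e = c\<^sub>3 ` e" for e
    by (intro image_cong refl f; blast)+
  note pv = g1.path_verts g2.path_verts g3.path_verts
  have "card (f ` e) = 2" if e: "e \<in> ring_edges - D" for e
  proof -
    have "e \<notin> D" using e by simp
    consider "e \<in> g1.gadget_edges" | "e \<in> g2.gadget_edges" | "e \<in> g3.gadget_edges"
      | "e = {z, u\<^sub>2}" | "e = {z, v\<^sub>2}" | "e = {z, w\<^sub>2}"
      using e by (simp only: ring_edges_def Un_iff Diff_iff insert_iff empty_iff) metis
    then show ?thesis
    proof cases
      case 1
      then have "e \<subseteq> verts G\<^sub>1" using g1.edge_props by blast
      moreover have "card (c\<^sub>1 ` e) = 2"
        using c(1) 1 \<open>e \<notin> D\<close> unfolding colouring_def by blast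
      ultimately show ?thesis using img(1) by simp
    next
      case 2
      then have "e \<subseteq> verts G\<^sub>2" using g2.edge_props by blast
      moreover have "card (c\<^sub>2 ` e) = 2"
        using c(2) 2 \<open>e \<notin> D\<close> unfolding colouring_def by blast
      ultimately show ?thesis using img(2) by simp
    next
      case 3
      then have "e \<subseteq> verts G\<^sub>3" using g3.edge_props by blast
      moreover have "card (c\<^sub>3 ` e) = 2"
        using c(3) 3 \<open>e \<notin> D\<close> unfolding colouring_def by blast
      ultimately show ?thesis using img(3) by simp
    qed (use s f pv \<open>e \<notin> D\<close> in auto)
  qed
  moreover have "f ` ring_verts \<subseteq> {..<k}"
    using f s(1) c[THEN colouring_bound] by (auto simp: ring_verts_def)
  ultimately have "ring_colouring k D f"
    unfolding ring_colouring_def colouring_def using f pv junctions by simp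
  then show thesis by (rule that)
qed

text \<open>Every gadget separates its ends, so the junctions use up all three colours.\<close>

lemma no_ring_3_colouring: "\<not> ring_colouring 3 {} f"
proof
  assume f: "ring_colouring 3 {} f"
  then have col: "colouring 3 ring_verts ring_edges f"
    and junctions: "f u\<^sub>3 = f v\<^sub>1" "f v\<^sub>3 = f w\<^sub>1" "f w\<^sub>3 = f u\<^sub>1"
    unfolding ring_colouring_def by auto
  have restricted: "colouring 3 (verts G\<^sub>1) g1.gadget_edges f"
    "colouring 3 (verts G\<^sub>2) g2.gadget_edges f"
    "colouring 3 (verts G\<^sub>3) g3.gadget_edges f"
    using col unfolding colouring_def ring_verts_def ring_edges_def by auto
  note forced = g1.gadget_forces[OF restricted(1)] g2.gadget_forces[OF restricted(2)]
    g3.gadget_forces[OF restricted(3)]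
  have "f z \<noteq> f u\<^sub>2" "f z \<noteq> f v\<^sub>2" "f z \<noteq> f w\<^sub>2"
    by (rule colouring_edge[OF col], simp add: ring_edges_def)+
  moreover have "f z < 3" "f u\<^sub>3 < 3" "f v\<^sub>3 < 3" "f w\<^sub>3 < 3"
    by (rule colouring_bound[OF col],
        use g1.path_verts g2.path_verts g3.path_verts in \<open>simp add: ring_verts_def\<close>)+
  ultimately have "card {f z, f u\<^sub>3, f v\<^sub>3, f w\<^sub>3} = 4" "{f z, f u\<^sub>3, f v\<^sub>3, f w\<^sub>3} \<subseteq> {..<3}"
    using forced junctions by auto
  then show False
    using card_mono[of "{..<3::nat}" "{f z, f u\<^sub>3, f v\<^sub>3, f w\<^sub>3}"] by simp
qed

lemma ring_4_colouring: obtains f where "ring_colouring 4 {} f"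
proof -
  obtain c\<^sub>1 where c1: "colouring 3 (verts G\<^sub>1) g1.gadget_edges c\<^sub>1"
    "c\<^sub>1 u\<^sub>1 = 0" "c\<^sub>1 u\<^sub>2 = 1" "c\<^sub>1 u\<^sub>3 = 1" by (rule g1.gadget_realises[of 0 1]) auto
  obtain c\<^sub>2 where c2: "colouring 3 (verts G\<^sub>2) g2.gadget_edges c\<^sub>2"
    "c\<^sub>2 v\<^sub>1 = 1" "c\<^sub>2 v\<^sub>2 = 2" "c\<^sub>2 v\<^sub>3 = 2" by (rule g2.gadget_realises[of 1 2]) auto
  obtain c\<^sub>3 where c3: "colouring 3 (verts G\<^sub>3) g3.gadget_edges c\<^sub>3"
    "c\<^sub>3 w\<^sub>1 = 2" "c\<^sub>3 w\<^sub>2 = 0" "c\<^sub>3 w\<^sub>3 = 0" by (rule g3.gadget_realises[of 2 0]) auto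
  have "colouring 4 (verts G\<^sub>1) (g1.gadget_edges - {}) c\<^sub>1"
    "colouring 4 (verts G\<^sub>2) (g2.gadget_edges - {}) c\<^sub>2"
    "colouring 4 (verts G\<^sub>3) (g3.gadget_edges - {}) c\<^sub>3"
    using c1(1) c2(1) c3(1) by (auto intro: colouring_mono_colours)
  then show thesis
    by (rule glue_colourings[where s = 3]) (use c1 c2 c3 that in auto)
qed

text \<open>
  The intact second and third gadgets make the junction \<open>v\<^sub>3 = w\<^sub>1\<close> differ from the other two
  junctions, and show its colour at \<open>v\<^sub>2\<close> and that of \<open>u\<^sub>1\<close> at \<open>w\<^sub>2\<close>. If the first gadget is
  damaged, \<open>u\<^sub>2\<close> and \<open>u\<^sub>3\<close> get different colours; then either \<open>u\<^sub>2\<close> has the colour of \<open>u\<^sub>1\<close>, or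
  the junction \<open>v\<^sub>3 = w\<^sub>1\<close> can take the colour of \<open>u\<^sub>2\<close>. In both cases \<open>z\<close> sees two colours.
\<close>

lemma recolour_after_deletion_in_first:
  assumes "e \<in> g1.gadget_edges \<union> {{z, u\<^sub>2}}"
  obtains f where "ring_colouring 3 {e} f"
proof -
  have "\<exists>c\<^sub>1 d s. colouring 3 (verts G\<^sub>1) (g1.gadget_edges - {e}) c\<^sub>1 \<and>
      d < 3 \<and> d \<noteq> c\<^sub>1 u\<^sub>1 \<and> d \<noteq> c\<^sub>1 u\<^sub>3 \<and>
      s < 3 \<and> s \<noteq> d \<and> s \<noteq> c\<^sub>1 u\<^sub>1 \<and> (e \<noteq> {z, u\<^sub>2} \<longrightarrow> s \<noteq> c\<^sub>1 u\<^sub>2)"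
  proof (cases "e = {z, u\<^sub>2}")
    case True
    \<comment> \<open>The spokes left lead to the colours 2 and 0, so \<open>z\<close> can take 1, the colour of \<open>u\<^sub>2\<close>.\<close>
    obtain c where c: "colouring 3 (verts G\<^sub>1) g1.gadget_edges c"
      "c u\<^sub>1 = 0" "c u\<^sub>2 = 1" "c u\<^sub>3 = 1" by (rule g1.gadget_realises[of 0 1]) auto
    then have "colouring 3 (verts G\<^sub>1) (g1.gadget_edges - {e}) c"
      by (auto intro: colouring_subset_edges)
    then show ?thesis
      using c True by (intro exI[of _ c] exI[of _ 2] exI[of _ 1]) auto
  next
    case False
    then have e: "e \<in> edges G\<^sub>1" "e \<noteq> {u\<^sub>2, u\<^sub>3}" using assms by auto
    obtain c where c: "colouring 3 (verts G\<^sub>1) (edges G\<^sub>1 - {e}) c"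
      using e(1) by (rule g1.colouring_without_edge)
    have "{u\<^sub>2, u\<^sub>3} \<in> edges G\<^sub>1 - {e}" using e(2) g1.path by (simp add: is_path3_def)
    with c have differ: "c u\<^sub>2 \<noteq> c u\<^sub>3" by (rule colouring_edge)
    have "c u\<^sub>2 < 3" using c g1.path_verts by (auto intro: colouring_bound)
    have "\<exists>d<3. d \<noteq> c u\<^sub>1 \<and> d \<noteq> c u\<^sub>3 \<and> (c u\<^sub>2 = c u\<^sub>1 \<or> c u\<^sub>2 = d)"
      using two_colours_leave_third[of "c u\<^sub>1" "c u\<^sub>3"] differ \<open>c u\<^sub>2 < 3\<close>
      by (cases "c u\<^sub>2 = c u\<^sub>1") auto
    then obtain d where d: "d < 3" "d \<noteq> c u\<^sub>1" "d \<noteq> c u\<^sub>3" "c u\<^sub>2 = c u\<^sub>1 \<or> c u\<^sub>2 = d" by blast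
    obtain s where s: "s < 3" "s \<noteq> d" "s \<noteq> c u\<^sub>1"
      using two_colours_leave_third by blast
    have "colouring 3 (verts G\<^sub>1) (g1.gadget_edges - {e}) c"
      using c by (rule colouring_subset_edges) auto
    then show ?thesis using d s by auto
  qed
  then obtain c\<^sub>1 d s where c1: "colouring 3 (verts G\<^sub>1) (g1.gadget_edges - {e}) c\<^sub>1"
    and d: "d < 3" "d \<noteq> c\<^sub>1 u\<^sub>1" "d \<noteq> c\<^sub>1 u\<^sub>3"
    and s: "s < 3" "s \<noteq> d" "s \<noteq> c\<^sub>1 u\<^sub>1" "e \<noteq> {z, u\<^sub>2} \<longrightarrow> s \<noteq> c\<^sub>1 u\<^sub>2"
    by auto
  have bounds: "c\<^sub>1 u\<^sub>1 < 3" "c\<^sub>1 u\<^sub>3 < 3"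
    using c1 g1.path_verts by (auto intro: colouring_bound)
  obtain c\<^sub>2 where c2: "colouring 3 (verts G\<^sub>2) g2.gadget_edges c\<^sub>2"
    "c\<^sub>2 v\<^sub>1 = c\<^sub>1 u\<^sub>3" "c\<^sub>2 v\<^sub>2 = d" "c\<^sub>2 v\<^sub>3 = d"
    using g2.gadget_realises[OF bounds(2) d(1)] d(3) by metis
  obtain c\<^sub>3 where c3: "colouring 3 (verts G\<^sub>3) g3.gadget_edges c\<^sub>3"
    "c\<^sub>3 w\<^sub>1 = d" "c\<^sub>3 w\<^sub>2 = c\<^sub>1 u\<^sub>1" "c\<^sub>3 w\<^sub>3 = c\<^sub>1 u\<^sub>1"
    using g3.gadget_realises[OF d(1) bounds(1)] d(2) by metis
  have "colouring 3 (verts G\<^sub>2) (g2.gadget_edges - {e}) c\<^sub>2"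
    "colouring 3 (verts G\<^sub>3) (g3.gadget_edges - {e}) c\<^sub>3"
    using c2(1) c3(1) by (auto intro: colouring_subset_edges)
  with c1 show thesis
    by (rule glue_colourings[where s = s]) (use c2 c3 s that in auto)
qed

text \<open>The ring is invariant under rotation, so the deleted edge may be assumed to lie at the first gadget.\<close>

lemma recolour_after_deletion:
  assumes "e \<in> ring_edges"
  obtains f where "ring_colouring 3 {e} f"
proof -
  interpret r2: gadget_ring G\<^sub>2 v\<^sub>1 v\<^sub>2 v\<^sub>3 G\<^sub>3 w\<^sub>1 w\<^sub>2 w\<^sub>3 G\<^sub>1 u\<^sub>1 u\<^sub>2 u\<^sub>3 z by (rule rotate)
  interpret r3: gadget_ring G\<^sub>3 w\<^sub>1 w\<^sub>2 w\<^sub>3 G\<^sub>1 u\<^sub>1 u\<^sub>2 u\<^sub>3 G\<^sub>2 v\<^sub>1 v\<^sub>2 v\<^sub>3 z by (rule r2.rotate)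
  have "r2.ring_verts = ring_verts" "r3.ring_verts = ring_verts"
    "r2.ring_edges = ring_edges" "r3.ring_edges = ring_edges"
    unfolding ring_verts_def r2.ring_verts_def r3.ring_verts_def
      ring_edges_def r2.ring_edges_def r3.ring_edges_def by auto
  then have rot: "r2.ring_colouring k D f \<longleftrightarrow> ring_colouring k D f"
    "r3.ring_colouring k D f \<longleftrightarrow> ring_colouring k D f" for k D f
    unfolding ring_colouring_def r2.ring_colouring_def r3.ring_colouring_def by auto
  consider "e \<in> g1.gadget_edges \<union> {{z, u\<^sub>2}}" | "e \<in> g2.gadget_edges \<union> {{z, v\<^sub>2}}"
    | "e \<in> g3.gadget_edges \<union> {{z, w\<^sub>2}}"
    using assms unfolding ring_edges_def by blast
  then show thesis
  proof cases
    case 1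
    then show ?thesis by (rule recolour_after_deletion_in_first) (rule that)
  next
    case 2
    then show ?thesis by (rule r2.recolour_after_deletion_in_first) (simp add: rot that)
  next
    case 3
    then show ?thesis by (rule r3.recolour_after_deletion_in_first) (simp add: rot that)
  qed
qed

section \<open>The composition as a quotient of the ring\<close>

definition merge :: "'a \<Rightarrow> 'a" where
  "merge = (\<lambda>x. if x = w\<^sub>3 then u\<^sub>1 else x) \<circ> (\<lambda>x. if x = v\<^sub>1 then u\<^sub>3 else x)
     \<circ> (\<lambda>x. if x = w\<^sub>1 then v\<^sub>3 else x)"

abbreviation composition :: "'a ugraph" where
  "composition \<equiv> compose3 G\<^sub>1 (u\<^sub>1, u\<^sub>2, u\<^sub>3) G\<^sub>2 (v\<^sub>1, v\<^sub>2, v\<^sub>3) G\<^sub>3 (w\<^sub>1, w\<^sub>2, w\<^sub>3) z"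

lemma merge_unaffected: "x \<notin> {v\<^sub>1, w\<^sub>1, w\<^sub>3} \<Longrightarrow> merge x = x"
  by (simp add: merge_def)

lemma unaffected: "a \<in> {z, u\<^sub>1, u\<^sub>2, u\<^sub>3, v\<^sub>2, v\<^sub>3, w\<^sub>2} \<Longrightarrow> a \<notin> {v\<^sub>1, w\<^sub>1, w\<^sub>3}"
  using disj z_new g1.path_verts g2.path_verts g3.path_verts g2.path_distinct g3.path_distinct
  by blast

lemma merge_fixes: "merge z = z" "merge u\<^sub>2 = u\<^sub>2" "merge v\<^sub>2 = v\<^sub>2" "merge w\<^sub>2 = w\<^sub>2"
  by (rule merge_unaffected[OF unaffected], simp)+

lemma merge_identifies:
  "merge u\<^sub>3 = merge v\<^sub>1" "merge v\<^sub>3 = merge w\<^sub>1" "merge w\<^sub>3 = merge u\<^sub>1"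
proof -
  have ne: "v\<^sub>1 \<noteq> w\<^sub>1" "w\<^sub>3 \<noteq> w\<^sub>1" "w\<^sub>3 \<noteq> v\<^sub>1"
    using disj g2.path_verts g3.path_verts g3.path_distinct by blast+
  have ne': "v\<^sub>3 \<noteq> v\<^sub>1" "v\<^sub>3 \<noteq> w\<^sub>3" "u\<^sub>3 \<noteq> w\<^sub>3"
    using unaffected[of v\<^sub>3] unaffected[of u\<^sub>3] by simp_all
  have "merge v\<^sub>1 = u\<^sub>3" "merge w\<^sub>1 = v\<^sub>3" "merge w\<^sub>3 = u\<^sub>1"
    by (simp_all add: merge_def ne ne')
  moreover have "merge u\<^sub>3 = u\<^sub>3" "merge v\<^sub>3 = v\<^sub>3" "merge u\<^sub>1 = u\<^sub>1"
    by (rule merge_unaffected[OF unaffected], simp)+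
  ultimately show "merge u\<^sub>3 = merge v\<^sub>1" "merge v\<^sub>3 = merge w\<^sub>1" "merge w\<^sub>3 = merge u\<^sub>1"
    by (simp_all only:)
qed

text \<open>
  Disjointness makes it immaterial whether the three edges are deleted from the union or each from
  its own graph.
\<close>

lemma delete_from_union:
  "delete_edges (graph_union G\<^sub>1 (graph_union G\<^sub>2 G\<^sub>3)) {{u\<^sub>2, u\<^sub>3}, {v\<^sub>2, v\<^sub>3}, {w\<^sub>2, w\<^sub>3}} =
    \<lparr>verts = verts G\<^sub>1 \<union> verts G\<^sub>2 \<union> verts G\<^sub>3,
     edges = g1.gadget_edges \<union> g2.gadget_edges \<union> g3.gadget_edges\<rparr>"
proof -
  have apart: "{a, b} \<notin> edges G" if "gadget G x y t" "a \<notin> verts G" for G :: "'a ugraph" and x y t a b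
    using gadget.edge_props[OF that(1)] that(2) by blast
  have "u\<^sub>2 \<notin> verts G\<^sub>2" "u\<^sub>2 \<notin> verts G\<^sub>3" "v\<^sub>2 \<notin> verts G\<^sub>1" "v\<^sub>2 \<notin> verts G\<^sub>3" "w\<^sub>2 \<notin> verts G\<^sub>1" "w\<^sub>2 \<notin> verts G\<^sub>2"
    using disj g1.path_verts(2) g2.path_verts(2) g3.path_verts(2) by blast+
  then have "{v\<^sub>2, v\<^sub>3} \<notin> edges G\<^sub>1" "{w\<^sub>2, w\<^sub>3} \<notin> edges G\<^sub>1" "{u\<^sub>2, u\<^sub>3} \<notin> edges G\<^sub>2"
    "{w\<^sub>2, w\<^sub>3} \<notin> edges G\<^sub>2" "{u\<^sub>2, u\<^sub>3} \<notin> edges G\<^sub>3" "{v\<^sub>2, v\<^sub>3} \<notin> edges G\<^sub>3"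
    using apart[OF g1.gadget_axioms] apart[OF g2.gadget_axioms] apart[OF g3.gadget_axioms]
    by simp_all
  then have "(edges G\<^sub>1 \<union> (edges G\<^sub>2 \<union> edges G\<^sub>3)) - {{u\<^sub>2, u\<^sub>3}, {v\<^sub>2, v\<^sub>3}, {w\<^sub>2, w\<^sub>3}}
      = g1.gadget_edges \<union> g2.gadget_edges \<union> g3.gadget_edges"
    by blast
  then show ?thesis
    by (simp add: delete_edges_def graph_union_def Un_assoc)
qed

lemma identify_merge:
  "identify u\<^sub>1 w\<^sub>3 (identify u\<^sub>3 v\<^sub>1 (identify v\<^sub>3 w\<^sub>1 \<lparr>verts = V, edges = E\<rparr>)) =
    \<lparr>verts = merge ` V, edges = (`) merge ` E\<rparr>"
  by (simp only: identify_def Let_def merge_def comp_def image_image ugraph.simps)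

lemma composition_eq: "composition = \<lparr>verts = merge ` ring_verts, edges = (`) merge ` ring_edges\<rparr>"
proof -
  have "{{z, x} |x. x \<in> {u\<^sub>2, v\<^sub>2, w\<^sub>2}} = (`) merge ` {{z, u\<^sub>2}, {z, v\<^sub>2}, {z, w\<^sub>2}}"
    using merge_fixes by auto
  then show ?thesis
    unfolding compose3_def prod.case delete_from_union identify_merge
    by (simp add: add_vertex_def ring_verts_def ring_edges_def merge_fixes image_Un)
qed

lemma ring_colouring_merge: "ring_colouring k D f \<Longrightarrow> f \<circ> merge = f"
  unfolding ring_colouring_def merge_def by (intro ext) (auto split: if_splits)

lemma composition_simple: "simple_graph composition"
proof -
  obtain f where f: "ring_colouring 4 {} f" by (rule ring_4_colouring)
  then have "colouring 4 ring_verts ring_edges (f \<circ> merge)"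
    using ring_colouring_merge[OF f] unfolding ring_colouring_def by simp
  then show ?thesis
    unfolding composition_eq
    using finite_ring_verts ring_edge_props by (intro simple_graph_quotient) auto
qed

lemma composition_colorable_iff:
  "colorable composition k \<longleftrightarrow> (\<exists>f. ring_colouring k {} f)"
proof -
  have "colorable composition k \<longleftrightarrow> (\<exists>c. colouring k ring_verts ring_edges (c \<circ> merge))"
    using colorable_iff_colouring[OF composition_simple]
    by (simp add: composition_eq colouring_pullback_iff)
  also have "\<dots> \<longleftrightarrow> (\<exists>f. ring_colouring k {} f)"
  proof
    assume "\<exists>c. colouring k ring_verts ring_edges (c \<circ> merge)"
    then obtain c where "colouring k ring_verts ring_edges (c \<circ> merge)" ..
    then have "ring_colouring k {} (c \<circ> merge)"
      unfolding ring_colouring_def using merge_identifies by simp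
    then show "\<exists>f. ring_colouring k {} f" by (rule exI[of _ "c \<circ> merge"])
  next
    assume "\<exists>f. ring_colouring k {} f"
    then obtain f where f: "ring_colouring k {} f" ..
    then show "\<exists>c. colouring k ring_verts ring_edges (c \<circ> merge)"
      using ring_colouring_merge[OF f] unfolding ring_colouring_def
      by (intro exI[of _ f]) simp
  qed
  finally show ?thesis .
qed

lemma composition_critical_edge:
  assumes "e \<in> edges composition"
  shows "colorable (delete_edges composition {e}) 3"
proof -
  obtain e' where e': "e' \<in> ring_edges" "e = merge ` e'"
    using assms by (auto simp: composition_eq)
  obtain f where f: "ring_colouring 3 {e'} f"
    using e'(1) by (rule recolour_after_deletion)
  then have "colouring 3 (merge ` ring_verts) ((`) merge ` (ring_edges - {e'})) f"
    using ring_colouring_merge[OF f]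
    unfolding ring_colouring_def by (simp add: colouring_pullback_iff)
  then have "colouring 3 (merge ` ring_verts) ((`) merge ` ring_edges - {e}) f"
    by (rule colouring_subset_edges) (auto simp: e'(2))
  then show ?thesis
    by (intro colouring_imp_colorable) (simp add: delete_edges_def composition_eq)
qed

lemma composition_four_critical: "four_critical composition"
proof -
  have "colorable composition (Suc 3)" "\<not> colorable composition 3"
    using ring_4_colouring no_ring_3_colouring by (auto simp: composition_colorable_iff)
  then have "chromatic_number composition = Suc 3"
    by (rule chromatic_number_eqI)
  then show ?thesis
    unfolding four_critical_def using composition_simple composition_critical_edge by simp
qed

end

theorem theorem2p1:
  fixes G\<^sub>1 G\<^sub>2 G\<^sub>3 :: "'a ugraph"
    and p\<^sub>1 p\<^sub>2 p\<^sub>3 :: "'a \<Rightarrow> real^2"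
    and \<gamma>\<^sub>1 \<gamma>\<^sub>2 \<gamma>\<^sub>3 :: "'a set \<Rightarrow> real \<Rightarrow> real^2"
    and u\<^sub>1 u\<^sub>2 u\<^sub>3 v\<^sub>1 v\<^sub>2 v\<^sub>3 w\<^sub>1 w\<^sub>2 w\<^sub>3 z :: 'a
  assumes "verts G\<^sub>1 \<inter> verts G\<^sub>2 = {}"
    and "verts G\<^sub>1 \<inter> verts G\<^sub>3 = {}"
    and "verts G\<^sub>2 \<inter> verts G\<^sub>3 = {}"
    and "four_critical G\<^sub>1" and "four_critical G\<^sub>2" and "four_critical G\<^sub>3"
    and "plane_embedding G\<^sub>1 p\<^sub>1 \<gamma>\<^sub>1"
    and "plane_embedding G\<^sub>2 p\<^sub>2 \<gamma>\<^sub>2"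
    and "plane_embedding G\<^sub>3 p\<^sub>3 \<gamma>\<^sub>3"
    and "facial_path3 G\<^sub>1 p\<^sub>1 \<gamma>\<^sub>1 u\<^sub>1 u\<^sub>2 u\<^sub>3"
    and "facial_path3 G\<^sub>2 p\<^sub>2 \<gamma>\<^sub>2 v\<^sub>1 v\<^sub>2 v\<^sub>3"
    and "facial_path3 G\<^sub>3 p\<^sub>3 \<gamma>\<^sub>3 w\<^sub>1 w\<^sub>2 w\<^sub>3"
    and "z \<notin> verts G\<^sub>1 \<union> verts G\<^sub>2 \<union> verts G\<^sub>3"
  shows "four_critical
    (compose3 G\<^sub>1 (u\<^sub>1, u\<^sub>2, u\<^sub>3) G\<^sub>2 (v\<^sub>1, v\<^sub>2, v\<^sub>3) G\<^sub>3 (w\<^sub>1, w\<^sub>2, w\<^sub>3) z)"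
proof -
  have "is_path3 G\<^sub>1 u\<^sub>1 u\<^sub>2 u\<^sub>3" "is_path3 G\<^sub>2 v\<^sub>1 v\<^sub>2 v\<^sub>3" "is_path3 G\<^sub>3 w\<^sub>1 w\<^sub>2 w\<^sub>3"
    using assms unfolding facial_path3_def by blast+
  then interpret gadget_ring G\<^sub>1 u\<^sub>1 u\<^sub>2 u\<^sub>3 G\<^sub>2 v\<^sub>1 v\<^sub>2 v\<^sub>3 G\<^sub>3 w\<^sub>1 w\<^sub>2 w\<^sub>3 z
    using assms by unfold_locales auto
  show ?thesis by (rule composition_four_critical)
qed

end
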